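(* Consider the square-lattice discrete Laplacian model with spin $S\ge2$ ($S$ integer or half-integer) and open boundary conditions on the sites $\{0,1,\dots,L+1\}^2$, evolving by a reversible Markov process. Let $\xi_x,\xi_y$ be nonzero real numbers with $|\xi_x|<1$, $|\xi_y|<1$ and $$\xi_x+\frac1{\xi_x}+\xi_y+\frac1{\xi_y}=4$$ (such pairs exist). Then $\mathcal Q=\sum_{i,j}(\xi_x)^i(\xi_y)^j s_{i,j}$ is a conserved quantity, and for every fixed site $(x,y)$ (at a distance from the corner $(0,0)$ not scaling with $L$), the infinite-time average of the infinite-temperature autocorrelation at $(x,y)$ is bounded below by $$M_{x,y}=\frac{S(S+1)}{3}\,\frac{(\xi_x)^{2x}(\xi_y)^{2y}}{\sum_{i,j}(\xi_x)^{2i}(\xi_y)^{2j}}\;\xrightarrow[L\to\infty]{}\;\frac{S(S+1)}{3}(\xi_x)^{2x}(\xi_y)^{2y}\big(1-\xi_x^2\big)\big(1-\xi_y^2\big)>0.$$ In particular, the time-averaged autocorrelation at $(x,y)$ remains finite (non-vanishing) as $L\to\infty$.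
   Context: Each site $(i,j)\in\{0,\dots,L+1\}^2$ carries a spin $s_{i,j}\in\{-S,-S+1,\dots,S\}$. The elementary updates are centered at the interior sites $(i,j)\in\{1,\dots,L\}^2$: the gate changes $s_{i,j}\mapsto s_{i,j}-4$ and adds $1$ to each of the four nearest-neighbor spins $s_{i\pm1,j},s_{i,j\pm1}$; the inverse gate does the opposite. An update is applied only if all resulting spins remain in $\{-S,\dots,S\}$. The dynamics is a discrete-time Markov chain on spin configurations, with symmetric transition matrix $T_{\mathbf s,\mathbf s'}=T_{\mathbf s',\mathbf s}$, in which at each time step a random collection of such allowed, non-overlapping updates is applied. A conserved quantity is a function of the configuration invariant under all allowed updates. Let $\langle s_{x,y}(t)s_{x,y}(0)\rangle$ denote the average over the initial configuration chosen uniformly among all $(2S+1)^{(L+2)^2}$ configurations and over realizations of the dynamics. The infinite-time average is $\lim_{\tau\to\infty}\frac1\tau\sum_{t=0}^{\tau}\langle s_{x,y}(t)s_{x,y}(0)\rangle$. The sums over $i,j$ run over all lattice sites. *)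

theory Defs
  imports "HOL-Probability.Probability"
begin

type_synonym site = "nat \<times> nat"
type_synonym config = "site \<Rightarrow> real"

definition sites :: "nat \<Rightarrow> site set" where
  "sites L = {0..L+1} \<times> {0..L+1}"

definition interior_sites :: "nat \<Rightarrow> site set" where
  "interior_sites L = {1..L} \<times> {1..L}"

definition spins :: "real \<Rightarrow> real set" where
  "spins S = {- S + real k | k. real k \<le> 2 * S}"

(* Configurations are extensional functions on the lattice, so that there are
   exactly (2S+1)^((L+2)^2) of them. *)
definition configs :: "real \<Rightarrow> nat \<Rightarrow> config set" where
  "configs S L = PiE (sites L) (\<lambda>_. spins S)"

(* The truncated subtraction is harmless: neighbours are only taken of interior sites. *)
definition neighbours :: "site \<Rightarrow> site set" where
  "neighbours = (\<lambda>(i, j). {(i - 1, j), (i + 1, j), (i, j - 1), (i, j + 1)})"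

definition star :: "site \<Rightarrow> site set" where
  "star p = insert p (neighbours p)"

definition gate_change :: "site \<Rightarrow> site \<Rightarrow> real" where
  "gate_change p q = (if q = p then - 4 else if q \<in> neighbours p then 1 else 0)"

(* An update is a pair (p, a): a = 1 is the gate centred at p and a = -1 its inverse. *)
type_synonym update = "site \<times> real"

definition updates :: "nat \<Rightarrow> update set" where
  "updates L = interior_sites L \<times> {1, - 1}"

definition apply_update :: "update \<Rightarrow> config \<Rightarrow> config" where
  "apply_update = (\<lambda>(p, a) s q. s q + a * gate_change p q)"

definition allowed :: "real \<Rightarrow> nat \<Rightarrow> config \<Rightarrow> update \<Rightarrow> bool" where
  "allowed S L s u \<longleftrightarrow> u \<in> updates L \<and> apply_update u s \<in> configs S L"

(* Non-overlapping: the five-site supports of the updates are pairwise disjoint. *)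
definition allowed_collection :: "real \<Rightarrow> nat \<Rightarrow> config \<Rightarrow> update set \<Rightarrow> bool" where
  "allowed_collection S L s G \<longleftrightarrow>
     (\<forall>u\<in>G. allowed S L s u) \<and>
     (\<forall>u\<in>G. \<forall>v\<in>G. u \<noteq> v \<longrightarrow> star (fst u) \<inter> star (fst v) = {})"

definition apply_collection :: "update set \<Rightarrow> config \<Rightarrow> config" where
  "apply_collection G s = (\<lambda>q. s q + (\<Sum>(p, a)\<in>G. a * gate_change p q))"

(* The transition matrix is T s s' = pmf (K s) s'. The law of the random collection
   of updates, given the current configuration, is arbitrary apart from symmetry of T. *)
definition laplacian_dynamics :: "real \<Rightarrow> nat \<Rightarrow> (config \<Rightarrow> config pmf) \<Rightarrow> bool" where
  "laplacian_dynamics S L K \<longleftrightarrow>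
     (\<forall>s\<in>configs S L. \<exists>C. (\<forall>G\<in>set_pmf C. allowed_collection S L s G) \<and>
                           K s = map_pmf (\<lambda>G. apply_collection G s) C) \<and>
     (\<forall>s\<in>configs S L. \<forall>s'\<in>configs S L. pmf (K s) s' = pmf (K s') s)"

definition conserved :: "real \<Rightarrow> nat \<Rightarrow> (config \<Rightarrow> real) \<Rightarrow> bool" where
  "conserved S L Q \<longleftrightarrow>
     (\<forall>s\<in>configs S L. \<forall>u. allowed S L s u \<longrightarrow> Q (apply_update u s) = Q s)"

primrec law_at :: "(config \<Rightarrow> config pmf) \<Rightarrow> nat \<Rightarrow> config \<Rightarrow> config pmf" where
  "law_at K 0 s = return_pmf s"
| "law_at K (Suc t) s = bind_pmf (law_at K t s) K"

definition autocorrelation ::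
  "real \<Rightarrow> nat \<Rightarrow> (config \<Rightarrow> config pmf) \<Rightarrow> site \<Rightarrow> nat \<Rightarrow> real" where
  "autocorrelation S L K p t =
     measure_pmf.expectation
       (bind_pmf (pmf_of_set (configs S L)) (\<lambda>s0. map_pmf (\<lambda>st. (st, s0)) (law_at K t s0)))
       (\<lambda>(st, s0). st p * s0 p)"

definition time_average :: "(nat \<Rightarrow> real) \<Rightarrow> nat \<Rightarrow> real" where
  "time_average f \<tau> = 1 / real \<tau> * (\<Sum>t=0..\<tau>. f t)"

definition charge :: "nat \<Rightarrow> real \<Rightarrow> real \<Rightarrow> config \<Rightarrow> real" where
  "charge L \<xi>x \<xi>y s = (\<Sum>(i, j)\<in>sites L. \<xi>x ^ i * \<xi>y ^ j * s (i, j))"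

definition mazur_bound :: "real \<Rightarrow> nat \<Rightarrow> real \<Rightarrow> real \<Rightarrow> nat \<Rightarrow> nat \<Rightarrow> real" where
  "mazur_bound S L \<xi>x \<xi>y x y =
     S * (S + 1) / 3 *
     ((\<xi>x ^ (2 * x) * \<xi>y ^ (2 * y)) / (\<Sum>(i, j)\<in>sites L. \<xi>x ^ (2 * i) * \<xi>y ^ (2 * j)))"

definition admissible_pair :: "real \<Rightarrow> real \<Rightarrow> bool" where
  "admissible_pair \<xi>x \<xi>y \<longleftrightarrow>
     \<xi>x \<noteq> 0 \<and> \<xi>y \<noteq> 0 \<and> \<bar>\<xi>x\<bar> < 1 \<and> \<bar>\<xi>y\<bar> < 1 \<and>
     \<xi>x + 1 / \<xi>x + \<xi>y + 1 / \<xi>y = 4"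

end

theory Submission
  imports Defs
begin

text \<open>Because the gate at an interior site is a discrete Laplacian, its effect on the charge is
  proportional to \<open>\<xi>x + 1 / \<xi>x + \<xi>y + 1 / \<xi>y - 4 = 0\<close>; so the charge \<open>Q\<close> is fixed by the transition
  operator \<open>T\<close>. Mazur's inequality is obtained without spectral theory. Since \<open>T\<close> is symmetric and
  stochastic, \<open>1 + T\<close> and \<open>1 - T\<close> are positive semidefinite. With \<open>g = T\<^sup>t f\<close>, the sum of the
  correlations at times \<open>2 t\<close> and \<open>2 t + 1\<close> is \<open>\<langle>g, (1 + T) g\<rangle>\<close>; it decreases with \<open>t\<close> (because
  \<open>1 - T \<ge> 0\<close>), and by Cauchy--Schwarz for the form \<open>1 + T\<close> it never falls below
  \<open>2 \<langle>f, Q\<rangle>\<^sup>2 / \<langle>Q, Q\<rangle>\<close>. Its limit is twice the time-averaged correlation. The spins are independent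
  and centred with variance \<open>S (S + 1) / 3\<close> in the uniform ensemble, which turns this into the stated bound.\<close>

section \<open>Correlations of a symmetric Markov chain\<close>

text \<open>The mean divides n + 1 terms by n, matching the normalisation of
  \<open>time_average\<close>. The terms before N contribute a fixed amount, negligible for large n.
  The later ones deviate by less than r / 4 each, and r / 4 rather than r / 2 absorbs the extra
  term, since n + 1 \<le> 2 n.\<close>

lemma cesaro_mean_tendsto:
  fixes d :: "nat \<Rightarrow> real"
  assumes "d \<longlonglongrightarrow> A"
  shows "(\<lambda>n. (\<Sum>t\<le>n. d t) / real n) \<longlonglongrightarrow> A"
proof -
  have small: "(\<lambda>n. (\<Sum>t\<le>n. d t - A) / real n) \<longlonglongrightarrow> 0"
  proof (rule LIMSEQ_I)
    fix r :: real assume "0 < r"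
    obtain N where N: "\<And>t. t \<ge> N \<Longrightarrow> \<bar>d t - A\<bar> < r / 4"
      using LIMSEQ_D[OF assms, of "r / 4"] \<open>0 < r\<close> by auto
    define M where "M = (\<Sum>t<N. \<bar>d t - A\<bar>)"
    have "M \<ge> 0" unfolding M_def by (rule sum_nonneg) simp
    obtain m :: nat where m: "real m > 2 * M / r" using reals_Archimedean2 by blast
    show "\<exists>n0. \<forall>n\<ge>n0. norm ((\<Sum>t\<le>n. d t - A) / real n - 0) < r"
    proof (intro exI[of _ "max 1 (max N m)"] allI impI)
      fix n assume n: "n \<ge> max 1 (max N m)"
      have "\<bar>\<Sum>t\<le>n. d t - A\<bar> \<le> (\<Sum>t\<le>n. \<bar>d t - A\<bar>)" by (rule sum_abs)
      also have "\<dots> = M + (\<Sum>t=N..n. \<bar>d t - A\<bar>)"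
      proof -
        have "{..n} = {..<N} \<union> {N..n}" using n by auto
        then show ?thesis unfolding M_def by (simp only:) (rule sum.union_disjoint, auto)
      qed
      also have "(\<Sum>t=N..n. \<bar>d t - A\<bar>) \<le> (\<Sum>t=N..n. r / 4)"
        by (rule sum_mono) (use N in \<open>auto intro: less_imp_le\<close>)
      also have "\<dots> \<le> real (n + 1) * (r / 4)"
        using \<open>0 < r\<close> by (simp add: mult_right_mono)
      also have "\<dots> \<le> real n * (r / 2)"
      proof -
        have "real n \<ge> 1" using n by simp
        then have "r * real n \<ge> r * 1" using \<open>0 < r\<close> by (intro mult_left_mono) auto
        then show ?thesis by (simp add: algebra_simps)
      qed
      finally have "\<bar>\<Sum>t\<le>n. d t - A\<bar> \<le> M + real n * (r / 2)" by simp
      also have "M < real n * (r / 2)"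
      proof -
        have "2 * M / r < real n" using m n by linarith
        then show ?thesis using \<open>0 < r\<close> by (simp add: field_simps)
      qed
      finally show "norm ((\<Sum>t\<le>n. d t - A) / real n - 0) < r"
        using n by (simp add: field_simps)
    qed
  qed
  have lim: "(\<lambda>n. (\<Sum>t\<le>n. d t - A) / real n + (A + A * inverse (real n))) \<longlonglongrightarrow> 0 + (A + A * 0)"
    by (intro tendsto_intros small lim_inverse_n)
  have "\<forall>\<^sub>F n in sequentially. (\<Sum>t\<le>n. d t - A) / real n + (A + A * inverse (real n))
      = (\<Sum>t\<le>n. d t) / real n"
    using eventually_gt_at_top[of 0]
    by eventually_elim (simp add: sum_subtractf field_simps)
  from Lim_transform_eventually[OF lim this] show ?thesis by simp
qed

section \<open>Quadratic forms of a symmetric stochastic matrix\<close>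

locale symmetric_stochastic =
  fixes X :: "'a set" and T :: "'a \<Rightarrow> 'a \<Rightarrow> real"
  assumes finite_X [simp]: "finite X"
    and nonneg: "\<And>s s'. s \<in> X \<Longrightarrow> s' \<in> X \<Longrightarrow> 0 \<le> T s s'"
    and sym: "\<And>s s'. s \<in> X \<Longrightarrow> s' \<in> X \<Longrightarrow> T s s' = T s' s"
    and row_sum: "\<And>s. s \<in> X \<Longrightarrow> (\<Sum>s'\<in>X. T s s') = 1"
begin

text \<open>The matrix acts on observables: for a chain, \<open>step u s\<close> is the expected
  value of \<open>u\<close> one time step after \<open>s\<close>. The product \<open>ip\<close> uses
  counting measure; the uniform normalisation enters only with
  \<open>autocorrelation\<close>.\<close>

definition step :: "('a \<Rightarrow> real) \<Rightarrow> 'a \<Rightarrow> real" where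
  "step u s = (\<Sum>s'\<in>X. T s s' * u s')"

definition ip :: "('a \<Rightarrow> real) \<Rightarrow> ('a \<Rightarrow> real) \<Rightarrow> real" where
  "ip u v = (\<Sum>s\<in>X. u s * v s)"

lemma ip_commute: "ip u v = ip v u"
  by (simp add: ip_def mult.commute)

lemma ip_add: "ip (\<lambda>s. a * u s + b * v s) w = a * ip u w + b * ip v w"
  by (simp add: ip_def sum.distrib sum_distrib_left algebra_simps)

lemma ip_add_right: "ip w (\<lambda>s. a * u s + b * v s) = a * ip w u + b * ip w v"
  by (metis ip_add ip_commute)

lemma step_add: "step (\<lambda>s. a * u s + b * v s) = (\<lambda>s. a * step u s + b * step v s)"
  by (rule ext) (simp add: step_def sum.distrib sum_distrib_left algebra_simps)

lemma ip_step: "ip (step u) v = ip u (step v)"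
proof -
  have "ip (step u) v = (\<Sum>s\<in>X. \<Sum>s'\<in>X. T s s' * u s' * v s)"
    by (simp add: ip_def step_def sum_distrib_right)
  also have "\<dots> = (\<Sum>s'\<in>X. \<Sum>s\<in>X. T s s' * u s' * v s)" by (rule sum.swap)
  also have "\<dots> = ip u (step v)"
    unfolding ip_def step_def sum_distrib_left
    by (intro sum.cong refl) (simp add: sym)
  finally show ?thesis .
qed

text \<open>Self-adjointness moves n of the factors to the other side. With m = t and n = t or t +
  1, correlations at times 2 t and 2 t + 1 become quadratic forms in T^t u.\<close>

lemma ip_funpow_step: "ip ((step ^^ (m + n)) u) v = ip ((step ^^ m) u) ((step ^^ n) v)"
proof (induction n arbitrary: v)
  case (Suc n)
  have "ip ((step ^^ (m + Suc n)) u) v = ip ((step ^^ (m + n)) u) (step v)"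
    by (simp add: ip_step)
  also have "\<dots> = ip ((step ^^ m) u) ((step ^^ n) (step v))" by (rule Suc)
  finally show ?case by (simp add: funpow_swap1)
qed simp

text \<open>Twice the claimed quantity is a sum of squares weighted by \<open>T\<close>. The signs c
  = 1 and c = -1 give positivity of 1 + T and of 1 - T.\<close>

lemma dirichlet_form_nonneg:
  assumes "c\<^sup>2 = 1"
  shows "0 \<le> ip u u + c * ip u (step u)"
proof -
  have "0 \<le> (\<Sum>s\<in>X. \<Sum>s'\<in>X. T s s' * (u s + c * u s')\<^sup>2)"
    by (intro sum_nonneg mult_nonneg_nonneg nonneg) auto
  also have "\<dots> = (\<Sum>s\<in>X. \<Sum>s'\<in>X. T s s' * (u s)\<^sup>2) + (\<Sum>s\<in>X. \<Sum>s'\<in>X. T s s' * (u s')\<^sup>2)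
      + 2 * c * (\<Sum>s\<in>X. \<Sum>s'\<in>X. u s * (T s s' * u s'))"
    unfolding sum_distrib_left sum.distrib[symmetric]
  proof (intro sum.cong refl)
    fix s s'
    have "(u s + c * u s')\<^sup>2 = (u s)\<^sup>2 + c\<^sup>2 * (u s')\<^sup>2 + 2 * c * u s * u s'"
      by (simp add: power2_eq_square algebra_simps)
    then show "T s s' * (u s + c * u s')\<^sup>2 = T s s' * (u s)\<^sup>2 + T s s' * (u s')\<^sup>2
        + 2 * c * (u s * (T s s' * u s'))"
      using assms by (simp add: algebra_simps)
  qed
  also have "(\<Sum>s\<in>X. \<Sum>s'\<in>X. T s s' * (u s)\<^sup>2) = ip u u"
    by (simp add: ip_def sum_distrib_right[symmetric] row_sum power2_eq_square)
  \<comment> \<open>Column sums are needed here; symmetry turns them into row sums.\<close>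
  also have "(\<Sum>s\<in>X. \<Sum>s'\<in>X. T s s' * (u s')\<^sup>2) = (\<Sum>s'\<in>X. \<Sum>s\<in>X. T s' s * (u s')\<^sup>2)"
    by (subst sum.swap) (intro sum.cong refl, simp add: sym)
  also have "\<dots> = ip u u"
    by (simp add: ip_def sum_distrib_right[symmetric] row_sum power2_eq_square)
  also have "(\<Sum>s\<in>X. \<Sum>s'\<in>X. u s * (T s s' * u s')) = ip u (step u)"
    by (simp add: ip_def step_def sum_distrib_left)
  finally show ?thesis by simp
qed

lemma ip_self_nonneg: "0 \<le> ip u u"
  by (simp add: ip_def sum_nonneg)

lemma abs_ip_step_le: "\<bar>ip u (step u)\<bar> \<le> ip u u"
  using dirichlet_form_nonneg[of 1 u] dirichlet_form_nonneg[of "-1" u] by simp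

text \<open>The quadratic form of 1 + T. Correlations at single times may oscillate forever because
  T can have eigenvalue -1; the factor 1 + T annihilates that part.\<close>

definition pair_corr :: "('a \<Rightarrow> real) \<Rightarrow> real" where
  "pair_corr u = ip u u + ip u (step u)"

lemma pair_corr_nonneg: "0 \<le> pair_corr u"
  using dirichlet_form_nonneg[of 1 u] by (simp add: pair_corr_def)

text \<open>The first inequality is positivity of \<open>1 - T\<close> on \<open>(1 + T) u\<close>; the second follows from
  \<open>2 (1 - T\<^sup>2) = (1 + T) (1 - T) (1 + T) + (1 - T) (1 + T) (1 - T)\<close>.\<close>

lemma
  shows pair_corr_step_le: "pair_corr (step u) \<le> pair_corr u"
    and ip_step_step_le: "ip (step u) (step u) \<le> ip u u"
proof -
  \<comment> \<open>The coefficients 1 are written out so that \<open>step_add\<close>,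
    \<open>ip_add\<close> and \<open>ip_add_right\<close> apply as rewrite rules.\<close>
  let ?p = "\<lambda>s. 1 * u s + 1 * step u s"
  let ?m = "\<lambda>s. 1 * u s + (-1) * step u s"
  have swap: "ip (step u) u = ip u (step u)" "ip (step (step u)) u = ip (step u) (step u)"
     "ip u (step (step u)) = ip (step u) (step u)"
    by (simp_all add: ip_step)
  have p: "0 \<le> ip ?p ?p + (-1) * ip ?p (step ?p)" by (rule dirichlet_form_nonneg) simp
  have m: "0 \<le> ip ?m ?m + 1 * ip ?m (step ?m)" by (rule dirichlet_form_nonneg) simp
  have p': "ip ?p ?p + (-1) * ip ?p (step ?p) = pair_corr u - pair_corr (step u)"
    unfolding step_add ip_add ip_add_right pair_corr_def swap by simp
  have m': "ip ?m ?m + 1 * ip ?m (step ?m) =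
     ip u u - ip u (step u) - ip (step u) (step u) + ip (step u) (step (step u))"
    unfolding step_add ip_add ip_add_right swap by simp
  show "pair_corr (step u) \<le> pair_corr u" using p p' by linarith
  show "ip (step u) (step u) \<le> ip u u" using p p' m m' unfolding pair_corr_def by linarith
qed

text \<open>Cauchy--Schwarz for the positive semidefinite form \<open>\<langle>u, (1 + T) v\<rangle>\<close>.\<close>

lemma pair_corr_invariant_bound:
  assumes inv: "\<And>s. s \<in> X \<Longrightarrow> step Q s = Q s"
  shows "2 * (ip u Q)\<^sup>2 \<le> pair_corr u * ip Q Q"
proof -
  let ?q = "ip Q Q" and ?c = "ip u Q"
  have ipQ: "ip w (step Q) = ip w Q" for w
    by (simp add: ip_def inv)
  \<comment> \<open>This is the component of \<open>u\<close> orthogonal to \<open>Q\<close>,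
    multiplied by \<langle>Q, Q\<rangle> to avoid a division. The price is the separate case of a
    vanishing norm.\<close>
  let ?w = "\<lambda>s. ?q * u s + (- ?c) * Q s"
  have "0 \<le> pair_corr ?w" by (rule pair_corr_nonneg)
  also have "pair_corr ?w = ?q * (?q * pair_corr u - 2 * ?c\<^sup>2)"
    unfolding pair_corr_def step_add ip_add ip_add_right ipQ
    using ipQ[of u] ip_step[of Q u] ip_commute[of Q u] ip_commute[of "step u" Q]
      ip_step[of u Q]
    by (simp add: power2_eq_square algebra_simps)
  finally have ge: "0 \<le> ?q * (?q * pair_corr u - 2 * ?c\<^sup>2)" .
  show ?thesis
  proof (cases "?q = 0")
    case True
    then have "\<forall>s\<in>X. Q s = 0"
      by (simp add: ip_def sum_nonneg_eq_0_iff)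
    then have "?c = 0" by (simp add: ip_def)
    with True show ?thesis by simp
  next
    case False
    then have "?q > 0" using ip_self_nonneg[of Q] by linarith
    with ge have "0 \<le> ?q * pair_corr u - 2 * ?c\<^sup>2" by (simp add: zero_le_mult_iff)
    then show ?thesis by (simp add: mult.commute)
  qed
qed

text \<open>Each T moves onto \<open>Q\<close> and is absorbed there. Hence the lower bound on
  \<open>pair_corr\<close> is the same for all T^t u.\<close>

lemma ip_funpow_invariant:
  assumes inv: "\<And>s. s \<in> X \<Longrightarrow> step Q s = Q s"
  shows "ip ((step ^^ n) u) Q = ip u Q"
proof (induction n)
  case (Suc n)
  have "ip ((step ^^ Suc n) u) Q = ip ((step ^^ n) u) (step Q)" by (simp add: ip_step)
  also have "\<dots> = ip ((step ^^ n) u) Q" by (simp add: ip_def inv)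
  finally show ?case using Suc by simp
qed simp

theorem time_average_correlation_tendsto:
  obtains l where "time_average (\<lambda>t. ip ((step ^^ t) u) u) \<longlonglongrightarrow> l"
    and "l \<le> ip u u"
    and "\<And>Q. (\<And>s. s \<in> X \<Longrightarrow> step Q s = Q s) \<Longrightarrow> (ip u Q)\<^sup>2 \<le> l * ip Q Q"
proof -
  define c where "c t = ip ((step ^^ t) u) u" for t
  define g where "g t = (step ^^ t) u" for t
  have c_even: "c (2 * t) = ip (g t) (g t)" for t
    using ip_funpow_step[of t t u u] by (simp add: c_def g_def mult_2)
  have c_odd: "c (2 * t + 1) = ip (g t) (step (g t))" for t
    using ip_funpow_step[of t "t + 1" u u] by (simp add: c_def g_def mult_2)
  have g_Suc: "g (Suc t) = step (g t)" for t by (simp add: g_def)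
  have pair: "c (2 * t) + c (2 * t + 1) = pair_corr (g t)" for t
    by (simp only: c_even c_odd pair_corr_def)
  have dec_even: "decseq (\<lambda>t. c (2 * t))"
    by (rule decseq_SucI) (simp only: c_even g_Suc ip_step_step_le)
  have dec_pair: "decseq (\<lambda>t. pair_corr (g t))"
    by (rule decseq_SucI) (simp only: g_Suc pair_corr_step_le)
  \<comment> \<open>Even-time correlations are squared norms of \<open>g t\<close>, hence decreasing
    and nonnegative. Their convergence permits shifting the pairing of times by one below.\<close>
  obtain c0 where c0: "(\<lambda>t. c (2 * t)) \<longlonglongrightarrow> c0"
    using decseq_convergent[OF dec_even, of 0] by (auto simp only: c_even ip_self_nonneg)
  obtain A where A: "(\<lambda>t. pair_corr (g t)) \<longlonglongrightarrow> A" and A_le: "\<And>t. A \<le> pair_corr (g t)"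
    using decseq_convergent[OF dec_pair, of 0] by (auto simp only: pair_corr_nonneg)
  have bound: "\<bar>c t\<bar> \<le> c 0" for t
  proof -
    have ev: "c (2 * k) \<le> c 0" for k
      using decseqD[OF dec_even, of 0 k] by simp
    show ?thesis
    proof (cases "even t")
      case True
      then obtain k where "t = 2 * k" by blast
      then show ?thesis using ev[of k] ip_self_nonneg[of "g k"] by (simp only: c_even)
    next
      case False
      then obtain k where "t = 2 * k + 1" using oddE by blast
      then show ?thesis using ev[of k] abs_ip_step_le[of "g k"] by (simp only: c_odd c_even)
    qed
  qed
  \<comment> \<open>Overlapping pairs: at even times \<open>d\<close> is \<open>pair_corr\<close>,
    and at odd times it differs from it by an increment of the even correlations, which tends to
    0.\<close>
  define d where "d t = c t + c (Suc t)" for t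
  have d_even: "(\<lambda>t. d (2 * t)) \<longlonglongrightarrow> A"
    using A pair by (simp add: d_def)
  have "(\<lambda>t. pair_corr (g t) - c (2 * t) + c (2 * Suc t)) \<longlonglongrightarrow> A - c0 + c0"
    by (intro tendsto_intros A c0 LIMSEQ_Suc[OF c0])
  moreover have "pair_corr (g t) - c (2 * t) + c (2 * Suc t) = d (2 * t + 1)" for t
    unfolding pair[symmetric] by (simp add: d_def)
  ultimately have d_odd: "(\<lambda>t. d (2 * t + 1)) \<longlonglongrightarrow> A" by simp
  have cesaro: "(\<lambda>n. (\<Sum>t\<le>n. d t) / real n) \<longlonglongrightarrow> A"
    by (rule cesaro_mean_tendsto[OF limseq_even_odd[OF d_even d_odd]])
  \<comment> \<open>Summing \<open>d\<close> counts every correlation twice, except that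
    \<open>c 0\<close> is missing once and \<open>c (Suc n)\<close> is extra. Both are bounded by
    \<open>c 0\<close>, so they vanish after division by n.\<close>
  have edge: "(\<lambda>n. (c 0 - c (Suc n)) * inverse (real n)) \<longlonglongrightarrow> 0"
  proof (rule tendsto_0_le[OF lim_inverse_n, where K = "2 * c 0"])
    show "\<forall>\<^sub>F n in sequentially.
        norm ((c 0 - c (Suc n)) * inverse (real n)) \<le> norm (inverse (real n)) * (2 * c 0)"
    proof (rule always_eventually, rule allI)
      fix n
      have "\<bar>c 0 - c (Suc n)\<bar> \<le> 2 * c 0" using bound[of "Suc n"] by linarith
      then show "norm ((c 0 - c (Suc n)) * inverse (real n)) \<le> norm (inverse (real n)) * (2 * c 0)"
        by (simp add: abs_mult mult.commute mult_left_mono)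
    qed
  qed
  have shift: "(\<Sum>t\<le>n. d t) = 2 * (\<Sum>t\<le>n. c t) - c 0 + c (Suc n)" for n
    by (induction n) (auto simp: d_def)
  have "time_average c n = ((\<Sum>t\<le>n. d t) / real n + (c 0 - c (Suc n)) * inverse (real n)) / 2" for n
  proof -
    have "(2 * s - a + b) / r + (a - b) * inverse r = 2 * (1 / r * s)" for s a b r :: real
      by (simp add: divide_inverse algebra_simps)
    then show ?thesis unfolding time_average_def shift atLeast0AtMost by simp
  qed
  then have "time_average c = (\<lambda>n. ((\<Sum>t\<le>n. d t) / real n + (c 0 - c (Suc n)) * inverse (real n)) / 2)"
    by (rule ext)
  moreover have "(\<lambda>n. ((\<Sum>t\<le>n. d t) / real n + (c 0 - c (Suc n)) * inverse (real n)) / 2)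
      \<longlonglongrightarrow> (A + 0) / 2"
    by (intro tendsto_intros cesaro edge) simp
  ultimately have "time_average c \<longlonglongrightarrow> A / 2" by simp
  moreover have "A / 2 \<le> ip u u"
    using A_le[of 0] abs_ip_step_le[of u] by (simp add: pair_corr_def g_def)
  moreover have "(ip u Q)\<^sup>2 \<le> A / 2 * ip Q Q" if "\<And>s. s \<in> X \<Longrightarrow> step Q s = Q s" for Q
  proof -
    have "2 * (ip u Q)\<^sup>2 \<le> pair_corr (g t) * ip Q Q" for t
      using pair_corr_invariant_bound[OF that, of "g t"] ip_funpow_invariant[OF that, of t u]
      by (simp add: g_def)
    moreover have "(\<lambda>t. pair_corr (g t) * ip Q Q) \<longlonglongrightarrow> A * ip Q Q"
      by (intro tendsto_intros A)
    ultimately have "2 * (ip u Q)\<^sup>2 \<le> A * ip Q Q"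
      by (intro LIMSEQ_le_const) auto
    then show ?thesis by simp
  qed
  ultimately show thesis using that[of "A / 2"] by (simp add: c_def[abs_def])
qed

end

section \<open>Conservation of the charge\<close>

lemma finite_sites [simp]: "finite (sites L)"
  by (simp add: sites_def)

lemma sum_gate_change:
  assumes "admissible_pair \<xi>x \<xi>y" and "p \<in> interior_sites L"
  shows "(\<Sum>(i, j)\<in>sites L. \<xi>x ^ i * \<xi>y ^ j * gate_change p (i, j)) = 0"
proof -
  have nz: "\<xi>x \<noteq> 0" "\<xi>y \<noteq> 0" and eq: "\<xi>x + 1 / \<xi>x + \<xi>y + 1 / \<xi>y = 4"
    using assms by (auto simp: admissible_pair_def)
  obtain i0 j0 where p: "p = (i0, j0)" by fastforce
  \<comment> \<open>shifted by one, so that no truncated subtraction is left in the neighbours\<close>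
  define i j where "i = i0 - 1" and "j = j0 - 1"
  have ij: "p = (Suc i, Suc j)" "Suc i \<le> L" "Suc j \<le> L"
    using assms(2) by (auto simp: p interior_sites_def i_def j_def)
  let ?h = "\<lambda>(a, b). \<xi>x ^ a * \<xi>y ^ b * gate_change p (a, b)"
  \<comment> \<open>The centre is interior, so the open boundary cuts off no neighbour.\<close>
  have "sum ?h (sites L) = sum ?h (star p)"
    by (rule sum.mono_neutral_right)
      (use ij in \<open>auto simp: sites_def star_def neighbours_def gate_change_def split: if_splits\<close>)
  also have "\<dots> = \<xi>x ^ i * \<xi>y ^ j *
      (\<xi>y + \<xi>x\<^sup>2 * \<xi>y + \<xi>x + \<xi>x * \<xi>y\<^sup>2 - 4 * \<xi>x * \<xi>y)"
    unfolding star_def neighbours_def ij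
    by (simp add: gate_change_def neighbours_def power2_eq_square algebra_simps)
  \<comment> \<open>The polynomial is the defining relation of the pair with denominators
    cleared.\<close>
  also have "\<xi>y + \<xi>x\<^sup>2 * \<xi>y + \<xi>x + \<xi>x * \<xi>y\<^sup>2 - 4 * \<xi>x * \<xi>y
      = \<xi>x * \<xi>y * (\<xi>x + 1 / \<xi>x + \<xi>y + 1 / \<xi>y - 4)"
    using nz by (simp add: field_simps power2_eq_square)
  finally show ?thesis using eq by simp
qed

text \<open>The charge is linear and each gate contributes 0. Collections are treated at once
  because one time step applies a collection; a single update is the singleton case.\<close>

lemma charge_apply_collection:
  assumes "admissible_pair \<xi>x \<xi>y" and "G \<subseteq> updates L"
  shows "charge L \<xi>x \<xi>y (apply_collection G s) = charge L \<xi>x \<xi>y s"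
proof -
  have "charge L \<xi>x \<xi>y (apply_collection G s) = charge L \<xi>x \<xi>y s +
      (\<Sum>q\<in>sites L. \<Sum>u\<in>G. \<xi>x ^ fst q * \<xi>y ^ snd q * (snd u * gate_change (fst u) q))"
    by (simp add: charge_def apply_collection_def case_prod_unfold sum.distrib
        sum_distrib_left algebra_simps)
  also have "(\<Sum>q\<in>sites L. \<Sum>u\<in>G. \<xi>x ^ fst q * \<xi>y ^ snd q * (snd u * gate_change (fst u) q))
      = (\<Sum>u\<in>G. \<Sum>q\<in>sites L. \<xi>x ^ fst q * \<xi>y ^ snd q * (snd u * gate_change (fst u) q))"
    by (rule sum.swap)
  also have "\<dots> = (\<Sum>u\<in>G. snd u * (\<Sum>(i, j)\<in>sites L. \<xi>x ^ i * \<xi>y ^ j * gate_change (fst u) (i, j)))"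
    by (simp add: case_prod_unfold sum_distrib_left algebra_simps)
  also have "\<dots> = 0"
    by (rule sum.neutral) (use assms in \<open>auto simp: updates_def sum_gate_change\<close>)
  finally show ?thesis by simp
qed

lemma apply_collection_singleton: "apply_collection {u} s = apply_update u s"
  by (auto simp: apply_collection_def apply_update_def case_prod_unfold)

lemma conserved_charge:
  assumes "admissible_pair \<xi>x \<xi>y"
  shows "conserved S L (charge L \<xi>x \<xi>y)"
  unfolding conserved_def allowed_def
  using charge_apply_collection[OF assms, of "{u}" L for u] by (auto simp: apply_collection_singleton)

text \<open>Disjoint supports mean that at most one update acts on a given site. Each new spin is
  therefore the old one or the one produced by an update that is allowed on its own.\<close>

lemma apply_collection_in_configs:
  assumes s: "s \<in> configs S L" and G: "allowed_collection S L s G"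
  shows "apply_collection G s \<in> configs S L"
proof -
  have allowed: "apply_update u s \<in> configs S L" if "u \<in> G" for u
    using G that by (auto simp: allowed_collection_def allowed_def)
  have "finite G"
  proof (rule finite_subset)
    show "G \<subseteq> updates L" using G by (auto simp: allowed_collection_def allowed_def)
  qed (simp add: updates_def interior_sites_def)
  have cases: "apply_collection G s q = s q \<or> (\<exists>u\<in>G. apply_collection G s q = apply_update u s q)"
    for q
  proof (cases "\<exists>u\<in>G. q \<in> star (fst u)")
    case True
    then obtain u where u: "u \<in> G" "q \<in> star (fst u)" by blast
    have "gate_change (fst v) q = 0" if "v \<in> G - {u}" for v
    proof -
      have "q \<notin> star (fst v)" using G u that by (auto simp: allowed_collection_def)
      then show ?thesis by (simp add: gate_change_def star_def)
    qed
    then have "(\<Sum>(p, a)\<in>G. a * gate_change p q) = (\<Sum>(p, a)\<in>{u}. a * gate_change p q)"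
      using u \<open>finite G\<close> by (intro sum.mono_neutral_right) (auto simp: case_prod_unfold)
    then show ?thesis using u(1)
      by (auto simp: apply_collection_def apply_update_def case_prod_unfold intro!: bexI[of _ u])
  next
    case False
    then have "(\<Sum>(p, a)\<in>G. a * gate_change p q) = 0"
      by (intro sum.neutral) (auto simp: gate_change_def star_def)
    then show ?thesis by (simp add: apply_collection_def)
  qed
  show ?thesis
    unfolding configs_def
  proof (rule PiE_I)
    fix q assume "q \<in> sites L"
    then show "apply_collection G s q \<in> spins S"
      using cases[of q] s allowed unfolding configs_def by (metis PiE_mem)
  next
    \<comment> \<open>Extensionality is inherited the same way: \<open>s\<close> and the result of
      each single update are \<open>undefined\<close> off the lattice.\<close>
    fix q assume "q \<notin> sites L"
    then show "apply_collection G s q = undefined"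
      using cases[of q] s allowed unfolding configs_def by (metis PiE_arb)
  qed
qed

section \<open>The infinite-temperature ensemble\<close>

lemma spins_eq:
  assumes "2 * S = real m"
  shows "spins S = (\<lambda>k. - S + real k) ` {..m}"
  using assms by (auto simp: spins_def)

text \<open>Writing 2 S as a natural number m covers integer and half-integer spin together. The
  moments are unnormalised, whence the factor m + 1 beside the variance.\<close>

lemma spin_moments:
  assumes "2 * S = real m"
  shows "finite (spins S)" and "card (spins S) = m + 1"
    and "(\<Sum>a\<in>spins S. a) = 0"
    and "(\<Sum>a\<in>spins S. a\<^sup>2) = real (m + 1) * (S * (S + 1) / 3)"
proof -
  have inj: "inj_on (\<lambda>k. - S + real k) {..m}" by (auto simp: inj_on_def)
  have S: "S = real m / 2" using assms by simp
  show "finite (spins S)" by (simp add: spins_eq[OF assms])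
  show "card (spins S) = m + 1" unfolding spins_eq[OF assms] card_image[OF inj] by simp
  have s1: "(\<Sum>k\<le>n. real k) = real n * (real n + 1) / 2" for n
    by (induction n) (auto simp: field_simps)
  have s2: "(\<Sum>k\<le>n. (real k)\<^sup>2) = real n * (real n + 1) * (2 * real n + 1) / 6" for n
    by (induction n) (auto simp: field_simps power2_eq_square)
  show "(\<Sum>a\<in>spins S. a) = 0"
    unfolding spins_eq[OF assms] sum.reindex[OF inj] comp_def sum.distrib s1
    by (simp add: S field_simps)
  have "(\<Sum>a\<in>spins S. a\<^sup>2) = (\<Sum>k\<le>m. S\<^sup>2 - 2 * S * real k + (real k)\<^sup>2)"
    unfolding spins_eq[OF assms] sum.reindex[OF inj] comp_def
    by (intro sum.cong refl) (simp add: power2_eq_square algebra_simps)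
  also have "\<dots> = (real m + 1) * S\<^sup>2 - 2 * S * (\<Sum>k\<le>m. real k) + (\<Sum>k\<le>m. (real k)\<^sup>2)"
    by (simp add: sum.distrib sum_subtractf sum_distrib_left algebra_simps)
  also have "\<dots> = real (m + 1) * (S * (S + 1) / 3)"
    unfolding s1 s2 S by (simp add: field_simps power2_eq_square)
  finally show "(\<Sum>a\<in>spins S. a\<^sup>2) = real (m + 1) * (S * (S + 1) / 3)" .
qed

lemma finite_configs: "2 * S = real m \<Longrightarrow> finite (configs S L)"
  unfolding configs_def by (intro finite_PiE spin_moments) auto

lemma card_configs:
  assumes "2 * S = real m"
  shows "card (configs S L) = (m + 1) ^ card (sites L)"
  by (simp add: configs_def card_PiE spin_moments(2)[OF assms])

lemma config_moments:
  assumes m: "2 * S = real m" and p: "p \<in> sites L" and q: "q \<in> sites L"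
  shows "(\<Sum>s\<in>configs S L. s p * s q)
    = (if p = q then real (card (configs S L)) * (S * (S + 1) / 3) else 0)"
proof -
  \<comment> \<open>The monomial becomes a product over all sites with trivial factors away from
    \<open>p\<close> and \<open>q\<close>, so the sum over configurations factorises. For distinct
    sites the factor at \<open>p\<close> is the vanishing sum of all spin values.\<close>
  let ?f = "\<lambda>z a. (if z = p then a else 1) * (if z = q then a else 1 :: real)"
  have fac: "(\<Prod>z\<in>sites L. ?f z (s z)) = s p * s q" for s :: config
    using p q by (simp add: prod.distrib)
  have "(\<Sum>s\<in>configs S L. s p * s q) = (\<Sum>s\<in>PiE (sites L) (\<lambda>_. spins S). \<Prod>z\<in>sites L. ?f z (s z))"
    unfolding fac configs_def ..
  also have "\<dots> = (\<Prod>z\<in>sites L. \<Sum>a\<in>spins S. ?f z a)"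
    by (rule prod_sum_PiE[symmetric]) (use spin_moments[OF m] in auto)
  also have "\<dots> = (if p = q then real (card (configs S L)) * (S * (S + 1) / 3) else 0)"
  proof (cases "p = q")
    case True
    have "(\<Prod>z\<in>sites L. \<Sum>a\<in>spins S. ?f z a)
        = (\<Sum>a\<in>spins S. ?f p a) * (\<Prod>z\<in>sites L - {p}. \<Sum>a\<in>spins S. ?f z a)"
      using p by (simp add: prod.remove)
    also have "(\<Sum>a\<in>spins S. ?f p a) = real (m + 1) * (S * (S + 1) / 3)"
      using True spin_moments(4)[OF m] by (simp add: power2_eq_square)
    also have "(\<Prod>z\<in>sites L - {p}. \<Sum>a\<in>spins S. ?f z a) = (\<Prod>z\<in>sites L - {p}. real (m + 1))"
      using True spin_moments(2)[OF m] by (intro prod.cong) auto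
    also have "real (m + 1) * (S * (S + 1) / 3) * (\<Prod>z\<in>sites L - {p}. real (m + 1))
        = real (m + 1) ^ card (sites L) * (S * (S + 1) / 3)"
      using card.remove[OF finite_sites p] by simp
    finally show ?thesis using True by (simp add: card_configs[OF m])
  next
    case False
    have "(\<Sum>a\<in>spins S. ?f p a) = 0" using False spin_moments(3)[OF m] by simp
    then have "(\<Prod>z\<in>sites L. \<Sum>a\<in>spins S. ?f z a) = 0"
      using p by (intro prod_zero finite_sites bexI[of _ p])
    then show ?thesis using False by simp
  qed
  finally show ?thesis .
qed

section \<open>The Mazur bound\<close>

lemma set_pmf_dynamics:
  assumes "laplacian_dynamics S L K" and "s \<in> configs S L" and "s' \<in> set_pmf (K s)"
  shows "\<exists>G. allowed_collection S L s G \<and> s' = apply_collection G s"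
  using assms unfolding laplacian_dynamics_def by fastforce

lemma set_pmf_dynamics_subset:
  assumes "laplacian_dynamics S L K" and "s \<in> configs S L"
  shows "set_pmf (K s) \<subseteq> configs S L"
  using set_pmf_dynamics[OF assms] apply_collection_in_configs[OF assms(2)] by blast

lemma set_pmf_law_at_subset:
  assumes "laplacian_dynamics S L K" and "s \<in> configs S L"
  shows "set_pmf (law_at K t s) \<subseteq> configs S L"
  by (induction t) (use assms set_pmf_dynamics_subset in \<open>auto, blast\<close>)

text \<open>Configurations lead only to configurations, so restricting to \<open>configs S L\<close>
  loses no probability and rows still sum to 1.\<close>

lemma symmetric_stochastic_dynamics:
  assumes "2 * S = real m" and "laplacian_dynamics S L K"
  shows "symmetric_stochastic (configs S L) (\<lambda>s s'. pmf (K s) s')"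
proof
  show "pmf (K s) s' = pmf (K s') s" if "s \<in> configs S L" "s' \<in> configs S L" for s s'
    using assms(2) that by (auto simp: laplacian_dynamics_def)
  show "(\<Sum>s'\<in>configs S L. pmf (K s) s') = 1" if "s \<in> configs S L" for s
    using set_pmf_dynamics_subset[OF assms(2) that] finite_configs[OF assms(1)]
    by (intro sum_pmf_eq_1)
qed (auto simp: finite_configs[OF assms(1)])

text \<open>Carries the operator result over to the chain: the autocorrelation is \<open>ip\<close>
  divided by the number of configurations, and a function constant along all possible transitions is
  fixed by \<open>step\<close>.\<close>

lemma autocorrelation_limit:
  assumes m: "2 * S = real m" and K: "laplacian_dynamics S L K" and p: "p \<in> sites L"
  obtains l where "time_average (autocorrelation S L K p) \<longlonglongrightarrow> l"
    and "l \<le> S * (S + 1) / 3"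
    and "\<And>Q. (\<And>s s'. s \<in> configs S L \<Longrightarrow> s' \<in> set_pmf (K s) \<Longrightarrow> Q s' = Q s) \<Longrightarrow>
      (\<Sum>s\<in>configs S L. s p * Q s)\<^sup>2
        \<le> real (card (configs S L)) * l * (\<Sum>s\<in>configs S L. (Q s)\<^sup>2)"
proof -
  let ?X = "configs S L"
  interpret symmetric_stochastic ?X "\<lambda>s s'. pmf (K s) s'"
    by (rule symmetric_stochastic_dynamics[OF m K])
  have fin: "finite ?X" by simp
  have N: "card ?X > 0" by (simp add: card_configs[OF m])
  then have ne: "?X \<noteq> {}" by auto
  have step_eq: "step u s = measure_pmf.expectation (K s) u" if "s \<in> ?X" for u s
    using set_pmf_dynamics_subset[OF K that]
    by (subst integral_measure_pmf_real[of ?X]) (auto simp: step_def mult.commute)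
  have fin_law: "finite (set_pmf (law_at K t s))" if "s \<in> ?X" for s t
    using set_pmf_law_at_subset[OF K that] fin finite_subset by blast
  \<comment> \<open>The last time step is peeled off and turns the observable \<open>u\<close> into
    \<open>step u\<close>, so the induction generalises over \<open>u\<close>.\<close>
  have law: "measure_pmf.expectation (law_at K t s) u = (step ^^ t) u s" if "s \<in> ?X" for s t u
  proof (induction t arbitrary: u)
    case (Suc t)
    have "measure_pmf.expectation (law_at K (Suc t) s) u
        = (\<Sum>a\<in>?X. pmf (law_at K t s) a *\<^sub>R measure_pmf.expectation (K a) u)"
      unfolding law_at.simps
      by (rule pmf_expectation_bind)
        (use set_pmf_law_at_subset[OF K that] finite_subset[OF set_pmf_dynamics_subset[OF K] fin]
          in auto)
    also have "\<dots> = (\<Sum>a\<in>?X. step u a * pmf (law_at K t s) a)"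
      by (simp add: step_eq mult.commute)
    also have "\<dots> = measure_pmf.expectation (law_at K t s) (step u)"
      using set_pmf_law_at_subset[OF K that]
      by (subst integral_measure_pmf_real[of ?X]) auto
    also have "\<dots> = (step ^^ t) (step u) s" by (rule Suc)
    finally show ?case by (simp add: funpow_swap1)
  qed simp
  define f where "f = (\<lambda>s :: config. s p)"
  define n where "n = real (card ?X)"
  have auto_eq: "autocorrelation S L K p = (\<lambda>t. inverse n * ip ((step ^^ t) f) f)"
  proof
    fix t
    have "autocorrelation S L K p t = (\<Sum>s0\<in>?X. measure_pmf.expectation
        (map_pmf (\<lambda>st. (st, s0)) (law_at K t s0)) (\<lambda>(st, s0). st p * s0 p) /\<^sub>R real (card ?X))"
      unfolding autocorrelation_def
      by (rule pmf_expectation_bind_pmf_of_set) (use ne fin fin_law in auto)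
    also have "\<dots> = (\<Sum>s0\<in>?X. inverse n * ((step ^^ t) f s0 * f s0))"
    proof (intro sum.cong refl)
      fix s0 assume s0: "s0 \<in> ?X"
      show "measure_pmf.expectation (map_pmf (\<lambda>st. (st, s0)) (law_at K t s0))
          (\<lambda>(st, s0). st p * s0 p) /\<^sub>R real (card ?X) = inverse n * ((step ^^ t) f s0 * f s0)"
        using law[OF s0, of t f] by (simp add: f_def n_def)
    qed
    finally show "autocorrelation S L K p t = inverse n * ip ((step ^^ t) f) f"
      by (simp add: ip_def sum_distrib_left)
  qed
  obtain l where l: "time_average (\<lambda>t. ip ((step ^^ t) f) f) \<longlonglongrightarrow> l" "l \<le> ip f f"
    "\<And>Q. (\<And>s. s \<in> ?X \<Longrightarrow> step Q s = Q s) \<Longrightarrow> (ip f Q)\<^sup>2 \<le> l * ip Q Q"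
    by (rule time_average_correlation_tendsto[of f]) blast
  have n: "n > 0" using N by (simp add: n_def)
  have "time_average (autocorrelation S L K p)
      = (\<lambda>\<tau>. inverse n * time_average (\<lambda>t. ip ((step ^^ t) f) f) \<tau>)"
    unfolding auto_eq time_average_def by (simp add: sum_distrib_left[symmetric])
  then have "time_average (autocorrelation S L K p) \<longlonglongrightarrow> inverse n * l"
    by (simp only:) (intro tendsto_intros l(1))
  moreover have "inverse n * l \<le> S * (S + 1) / 3"
  proof -
    have "ip f f = n * (S * (S + 1) / 3)"
      using config_moments[OF m p p] by (simp add: ip_def f_def n_def)
    with l(2) n show ?thesis by (simp add: field_simps)
  qed
  moreover have "(\<Sum>s\<in>?X. s p * Q s)\<^sup>2 \<le> n * (inverse n * l) * (\<Sum>s\<in>?X. (Q s)\<^sup>2)"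
    if Q: "\<And>s s'. s \<in> ?X \<Longrightarrow> s' \<in> set_pmf (K s) \<Longrightarrow> Q s' = Q s" for Q
  proof -
    have "step Q s = Q s" if "s \<in> ?X" for s
    proof -
      have "step Q s = measure_pmf.expectation (K s) (\<lambda>_. Q s)"
        unfolding step_eq[OF that]
        by (rule integral_cong_AE) (use Q that in \<open>auto simp: AE_measure_pmf_iff\<close>)
      then show ?thesis by simp
    qed
    from l(3)[OF this] show ?thesis
      using n by (simp add: ip_def f_def power2_eq_square mult.assoc[symmetric])
  qed
  ultimately show thesis by (rule that[of "inverse n * l", folded n_def])
qed

section \<open>Evaluation for the exponential charge and the limit of large lattices\<close>

lemma charge_moments:
  assumes m: "2 * S = real m"
  shows "(x, y) \<in> sites L \<Longrightarrow> (\<Sum>s\<in>configs S L. s (x, y) * charge L \<xi>x \<xi>y s)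
      = \<xi>x ^ x * \<xi>y ^ y * (real (card (configs S L)) * (S * (S + 1) / 3))" (is "_ \<Longrightarrow> ?A")
    and "(\<Sum>s\<in>configs S L. (charge L \<xi>x \<xi>y s)\<^sup>2)
      = (\<Sum>(i, j)\<in>sites L. \<xi>x ^ (2 * i) * \<xi>y ^ (2 * j)) *
        (real (card (configs S L)) * (S * (S + 1) / 3))" (is ?B)
proof -
  let ?w = "\<lambda>q. \<xi>x ^ fst q * \<xi>y ^ snd q"
  let ?v = "real (card (configs S L)) * (S * (S + 1) / 3)"
  have charge: "charge L \<xi>x \<xi>y s = (\<Sum>q\<in>sites L. ?w q * s q)" for s
    by (simp add: charge_def case_prod_unfold)
  have one: "(\<Sum>s\<in>configs S L. s p * charge L \<xi>x \<xi>y s) = ?w p * ?v" if p: "p \<in> sites L" for p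
  proof -
    have "(\<Sum>s\<in>configs S L. s p * charge L \<xi>x \<xi>y s)
        = (\<Sum>s\<in>configs S L. \<Sum>q\<in>sites L. ?w q * (s p * s q))"
      by (simp add: charge sum_distrib_left mult_ac)
    also have "\<dots> = (\<Sum>q\<in>sites L. \<Sum>s\<in>configs S L. ?w q * (s p * s q))" by (rule sum.swap)
    also have "\<dots> = (\<Sum>q\<in>sites L. if p = q then ?w q * ?v else 0)"
      unfolding sum_distrib_left[symmetric]
      by (intro sum.cong refl) (subst config_moments[OF m p], auto)
    also have "\<dots> = ?w p * ?v" using p by simp
    finally show ?thesis .
  qed
  show "(x, y) \<in> sites L \<Longrightarrow> ?A" using one[of "(x, y)"] by simp
  \<comment> \<open>Only one of the two charge factors is expanded, so that \<open>one\<close>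
    evaluates the rest.\<close>
  have "(\<Sum>s\<in>configs S L. (charge L \<xi>x \<xi>y s)\<^sup>2)
      = (\<Sum>s\<in>configs S L. \<Sum>q\<in>sites L. ?w q * (s q * charge L \<xi>x \<xi>y s))"
    by (simp add: power2_eq_square charge sum_distrib_right mult_ac)
  also have "\<dots> = (\<Sum>q\<in>sites L. \<Sum>s\<in>configs S L. ?w q * (s q * charge L \<xi>x \<xi>y s))"
    by (rule sum.swap)
  also have "\<dots> = (\<Sum>q\<in>sites L. ?w q * (?w q * ?v))"
    unfolding sum_distrib_left[symmetric] by (intro sum.cong refl) (simp add: one)
  also have "\<dots> = (\<Sum>q\<in>sites L. \<xi>x ^ (2 * fst q) * \<xi>y ^ (2 * snd q)) * ?v"
    unfolding sum_distrib_right
    by (intro sum.cong refl) (simp add: power_even_eq power2_eq_square)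
  finally show ?B by (simp add: case_prod_unfold)
qed

lemma weight_sum_pos:
  fixes \<xi>x \<xi>y :: real
  assumes "\<xi>x \<noteq> 0" "\<xi>y \<noteq> 0"
  shows "0 < (\<Sum>(i, j)\<in>sites L. \<xi>x ^ (2 * i) * \<xi>y ^ (2 * j))"
proof (rule sum_pos)
  show "sites L \<noteq> {}" by (auto simp: sites_def)
qed (use assms in \<open>auto simp: power_mult\<close>)

lemma mazur_bound_le:
  assumes m: "2 * S = real m" and "S > 0" and adm: "admissible_pair \<xi>x \<xi>y"
    and p: "(x, y) \<in> sites L"
    and l: "(\<Sum>s\<in>configs S L. s (x, y) * charge L \<xi>x \<xi>y s)\<^sup>2
      \<le> real (card (configs S L)) * l * (\<Sum>s\<in>configs S L. (charge L \<xi>x \<xi>y s)\<^sup>2)"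
  shows "mazur_bound S L \<xi>x \<xi>y x y \<le> l"
proof -
  define n v W where "n = real (card (configs S L))" and "v = S * (S + 1) / 3"
    and "W = (\<Sum>(i, j)\<in>sites L. \<xi>x ^ (2 * i) * \<xi>y ^ (2 * j))"
  have n: "n > 0" by (simp add: n_def card_configs[OF m])
  have v: "v > 0" using \<open>S > 0\<close> by (simp add: v_def)
  have W: "W > 0" using weight_sum_pos adm by (simp add: W_def admissible_pair_def)
  have "(\<xi>x ^ x * \<xi>y ^ y * (n * v))\<^sup>2 \<le> n * l * (W * (n * v))"
    using l unfolding charge_moments(1)[OF m p] charge_moments(2)[OF m] n_def v_def W_def .
  \<comment> \<open>Both sides are written with the common positive factor n n v, which then
    cancels.\<close>
  moreover have "(\<xi>x ^ x * \<xi>y ^ y * (n * v))\<^sup>2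
      = (n * n * v) * (v * (\<xi>x ^ (2 * x) * \<xi>y ^ (2 * y)))"
    by (simp add: power_mult_distrib power_mult[symmetric] power2_eq_square[of n]
        power2_eq_square[of v] mult_ac)
  moreover have "n * l * (W * (n * v)) = (n * n * v) * (l * W)" by (simp add: algebra_simps)
  ultimately have "v * (\<xi>x ^ (2 * x) * \<xi>y ^ (2 * y)) \<le> l * W"
    using n v by simp
  then show ?thesis
    unfolding mazur_bound_def v_def[symmetric] W_def[symmetric]
    using W by (simp add: divide_le_eq)
qed

lemma mazur_bound_tendsto:
  assumes "\<bar>\<xi>x\<bar> < 1" "\<bar>\<xi>y\<bar> < 1"
  shows "(\<lambda>L. mazur_bound S L \<xi>x \<xi>y x y)
    \<longlonglongrightarrow> S * (S + 1) / 3 * \<xi>x ^ (2 * x) * \<xi>y ^ (2 * y) * (1 - \<xi>x\<^sup>2) * (1 - \<xi>y\<^sup>2)"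
proof -
  have geo: "(\<lambda>L. \<Sum>i=0..L+1. \<xi> ^ (2 * i)) \<longlonglongrightarrow> 1 / (1 - \<xi>\<^sup>2)" and sq: "\<xi>\<^sup>2 < 1"
    if "\<bar>\<xi>\<bar> < 1" for \<xi> :: real
  proof -
    show "\<xi>\<^sup>2 < 1" using that by (simp add: abs_square_less_1)
    then have "(\<lambda>i. (\<xi>\<^sup>2) ^ i) sums (1 / (1 - \<xi>\<^sup>2))" by (intro geometric_sums) simp
    then have "(\<lambda>n. \<Sum>i<n. (\<xi>\<^sup>2) ^ i) \<longlonglongrightarrow> 1 / (1 - \<xi>\<^sup>2)" by (simp add: sums_def)
    \<comment> \<open>Coordinates run from 0 to L + 1, giving L + 2 terms in each geometric
      series.\<close>
    from LIMSEQ_ignore_initial_segment[OF this, of 2]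
    have "(\<lambda>L. \<Sum>i<L + 2. (\<xi>\<^sup>2) ^ i) \<longlonglongrightarrow> 1 / (1 - \<xi>\<^sup>2)" .
    moreover have "(\<Sum>i<L + 2. (\<xi>\<^sup>2) ^ i) = (\<Sum>i=0..L+1. \<xi> ^ (2 * i))" for L
      by (intro sum.cong) (auto simp: power_mult)
    ultimately show "(\<lambda>L. \<Sum>i=0..L+1. \<xi> ^ (2 * i)) \<longlonglongrightarrow> 1 / (1 - \<xi>\<^sup>2)"
      by (simp only:)
  qed
  have "(\<lambda>L. S * (S + 1) / 3 * ((\<xi>x ^ (2 * x) * \<xi>y ^ (2 * y)) /
      ((\<Sum>i=0..L+1. \<xi>x ^ (2 * i)) * (\<Sum>j=0..L+1. \<xi>y ^ (2 * j)))))
    \<longlonglongrightarrow> S * (S + 1) / 3 * ((\<xi>x ^ (2 * x) * \<xi>y ^ (2 * y)) /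
      (1 / (1 - \<xi>x\<^sup>2) * (1 / (1 - \<xi>y\<^sup>2))))"
    by (intro tendsto_intros geo assms) (use sq[OF assms(1)] sq[OF assms(2)] in auto)
  then show ?thesis
    unfolding mazur_bound_def sites_def sum.cartesian_product[symmetric] sum_product[symmetric]
    by (simp add: mult_ac)
qed

text \<open>For 0 < \<xi> < 1 the sum \<xi> + 1 / \<xi> exceeds 2, and for -1 < \<xi> < 0 it is
  below -2, so the two numbers must have opposite signs. The witnesses solve \<xi> + 1 / \<xi> = 8
  and \<xi> + 1 / \<xi> = -4.\<close>

lemma admissible_pair_exists: "admissible_pair (4 - sqrt 15) (sqrt 3 - 2)"
proof -
  have s15: "sqrt 15 * sqrt 15 = 15" and s3: "sqrt 3 * sqrt 3 = (3 :: real)" by simp_all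
  have b15: "3 < sqrt 15" "sqrt 15 < 4" and b3: "1 < sqrt 3" "sqrt 3 < 2"
    by (simp_all add: real_less_rsqrt real_less_lsqrt)
  have "1 / (4 - sqrt 15) = 4 + sqrt 15" using b15 s15 by (simp add: field_simps)
  moreover have "1 / (sqrt 3 - 2) = - (sqrt 3 + 2)" using b3 s3 by (simp add: field_simps)
  ultimately show ?thesis using b15 b3 unfolding admissible_pair_def by (auto simp: abs_less_iff)
qed

text \<open>Each lattice size has its own dynamics \<open>K L\<close>, so the time averages need not
  converge in L. Remaining finite and non-vanishing is expressed by positive bounds, independent of
  L, that hold for all large L.\<close>

theorem mainTheorem5:
  fixes S :: real and K :: "nat \<Rightarrow> config \<Rightarrow> config pmf"
  assumes "S \<ge> 2" and "2 * S \<in> \<nat>"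
    and "\<And>L. laplacian_dynamics S L (K L)"
  shows "(\<exists>\<xi>x \<xi>y. admissible_pair \<xi>x \<xi>y) \<and>
    (\<forall>\<xi>x \<xi>y. admissible_pair \<xi>x \<xi>y \<longrightarrow>
      (\<forall>L. conserved S L (charge L \<xi>x \<xi>y)) \<and>
      (\<forall>x y.
        (\<forall>L. (x, y) \<in> sites L \<longrightarrow>
           convergent (time_average (autocorrelation S L (K L) (x, y))) \<and>
           mazur_bound S L \<xi>x \<xi>y x y
             \<le> lim (time_average (autocorrelation S L (K L) (x, y)))) \<and>
        (\<lambda>L. mazur_bound S L \<xi>x \<xi>y x y)
          \<longlonglongrightarrow> S * (S + 1) / 3 * \<xi>x ^ (2 * x) * \<xi>y ^ (2 * y) * (1 - \<xi>x\<^sup>2) * (1 - \<xi>y\<^sup>2) \<and>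
        0 < S * (S + 1) / 3 * \<xi>x ^ (2 * x) * \<xi>y ^ (2 * y) * (1 - \<xi>x\<^sup>2) * (1 - \<xi>y\<^sup>2) \<and>
        (\<exists>c C. 0 < c \<and>
           (\<forall>\<^sub>F L in sequentially.
              c \<le> lim (time_average (autocorrelation S L (K L) (x, y))) \<and>
              lim (time_average (autocorrelation S L (K L) (x, y))) \<le> C))))"
proof (intro conjI allI impI)
  show "\<exists>\<xi>x \<xi>y. admissible_pair \<xi>x \<xi>y" using admissible_pair_exists by blast
next
  fix \<xi>x \<xi>y L assume "admissible_pair \<xi>x \<xi>y"
  then show "conserved S L (charge L \<xi>x \<xi>y)" by (rule conserved_charge)
next
  fix \<xi>x \<xi>y :: real and x y :: nat
  assume adm: "admissible_pair \<xi>x \<xi>y"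
  obtain m where m: "2 * S = real m" using assms(2) by (auto elim: Nats_cases)
  have S: "S > 0" using assms(1) by simp
  have lt1: "\<bar>\<xi>x\<bar> < 1" "\<bar>\<xi>y\<bar> < 1" and nz: "\<xi>x \<noteq> 0" "\<xi>y \<noteq> 0"
    using adm by (auto simp: admissible_pair_def)
  let ?avg = "\<lambda>L. time_average (autocorrelation S L (K L) (x, y))"
  let ?M = "S * (S + 1) / 3 * \<xi>x ^ (2 * x) * \<xi>y ^ (2 * y) * (1 - \<xi>x\<^sup>2) * (1 - \<xi>y\<^sup>2)"
  have main: "convergent (?avg L)" "mazur_bound S L \<xi>x \<xi>y x y \<le> lim (?avg L)"
    "lim (?avg L) \<le> S * (S + 1) / 3" if p: "(x, y) \<in> sites L" for L
  proof -
    obtain l where l: "?avg L \<longlonglongrightarrow> l" "l \<le> S * (S + 1) / 3"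
      "\<And>Q. (\<And>s s'. s \<in> configs S L \<Longrightarrow> s' \<in> set_pmf (K L s) \<Longrightarrow> Q s' = Q s) \<Longrightarrow>
        (\<Sum>s\<in>configs S L. s (x, y) * Q s)\<^sup>2
          \<le> real (card (configs S L)) * l * (\<Sum>s\<in>configs S L. (Q s)\<^sup>2)"
      by (rule autocorrelation_limit[OF m assms(3) p]) blast
    have lim: "lim (?avg L) = l" using l(1) by (rule limI)
    show "convergent (?avg L)" using l(1) by (rule convergentI)
    show "lim (?avg L) \<le> S * (S + 1) / 3" unfolding lim by (rule l(2))
    have "charge L \<xi>x \<xi>y s' = charge L \<xi>x \<xi>y s"
      if s: "s \<in> configs S L" and s': "s' \<in> set_pmf (K L s)" for s s'
    proof -
      obtain G where G: "allowed_collection S L s G" "s' = apply_collection G s"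
        using set_pmf_dynamics[OF assms(3) s s'] by blast
      have "G \<subseteq> updates L" using G(1) by (auto simp: allowed_collection_def allowed_def)
      then show ?thesis unfolding G(2) by (rule charge_apply_collection[OF adm])
    qed
    from mazur_bound_le[OF m S adm p l(3)[OF this]]
    show "mazur_bound S L \<xi>x \<xi>y x y \<le> lim (?avg L)" unfolding lim .
  qed
  show "convergent (?avg L)" "mazur_bound S L \<xi>x \<xi>y x y \<le> lim (?avg L)"
    if "(x, y) \<in> sites L" for L using main[OF that] by blast+
  show tends: "(\<lambda>L. mazur_bound S L \<xi>x \<xi>y x y) \<longlonglongrightarrow> ?M"
    using lt1 by (rule mazur_bound_tendsto)
  show pos: "0 < ?M"
    using S lt1 nz by (auto intro!: mult_pos_pos simp: power_mult abs_square_less_1)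
  \<comment> \<open>Half the limiting value serves as lower constant and the single-site variance S
    (S + 1) / 3 as upper one; the fixed site belongs to the lattice once L is large.\<close>
  have "\<forall>\<^sub>F L in sequentially. ?M / 2 < mazur_bound S L \<xi>x \<xi>y x y"
    by (rule order_tendstoD(1)[OF tends]) (use pos in linarith)
  moreover have "\<forall>\<^sub>F L in sequentially. (x, y) \<in> sites L"
    using eventually_ge_at_top[of "max x y"] by eventually_elim (auto simp: sites_def)
  ultimately have "\<forall>\<^sub>F L in sequentially.
      ?M / 2 \<le> lim (?avg L) \<and> lim (?avg L) \<le> S * (S + 1) / 3"
  proof eventually_elim
    case (elim L)
    then show ?case using main(2,3)[of L] by linarith
  qed
  moreover have "0 < ?M / 2" using pos by linarith
  ultimately show "\<exists>c C. 0 < c \<and> (\<forall>\<^sub>F L in sequentially. c \<le> lim (?avg L) \<and> lim (?avg L) \<le> C)"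
    by blast
qed

end
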